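(* Let $n\ge1$, $B\in\mathcal{M}_{n\times n}(\mathbb{R})$, and let $(X,d)$ be a complete vector $B$-metric space such that the $B$-metric $d$ is continuous. Let $e=(1,1,\ldots,1)\in\mathbb{R}^n$ and let $f\colon X\to\mathbb{R}^n$ be a lower semicontinuous function bounded from below such that for every nonempty closed subset $F\subset X$ and every $\eta>0$ there exists a point $x_{\eta,F}\in F$ with $$f(x_{\eta,F})\le f(x)+\eta e\quad\text{for all }x\in F.$$ Then, for given $\varepsilon,\delta>0$ and $x_0\in X$ with $$f(x_0)\le f(x)+\varepsilon e\quad\text{for all }x\in X,$$ there exist a sequence $(x_k)_{k\ge0}\subset X$ (starting at the given $x_0$) and a point $x^\ast\in X$ such that $x_k\to x^\ast$ as $k\to\infty$, $$f(x^\ast)\le f(x_0),\qquad d(x^\ast,x_0)\le\delta e,$$ and, for $x\in X$, $$f(x^\ast)+\tfrac{\varepsilon}{\delta}d(x^\ast,x_k)\ge f(x)+\tfrac{\varepsilon}{\delta}d(x,x_k)\ \text{ for all }k\ge0\quad\text{implies}\quad x=x^\ast.$$ Moreover, for $x\in X$, $$f(x^\ast)\ge f(x)+\tfrac{\varepsilon}{\delta}B\,d(x^\ast,x)+\tfrac{\varepsilon}{\delta}(B-I)\,d(x^\ast,x_k)\ \text{ for all }k\ge0\quad\text{implies}\quad x=x^\ast.$$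
   Context: Vectors in $\mathbb{R}^n$ are columns; inequalities between vectors and convergence of sequences of vectors are understood componentwise; $I$ is the $n\times n$ identity matrix. For a set $X$ and an arbitrary matrix $B\in\mathcal{M}_{n\times n}(\mathbb{R})$, a vector $B$-metric on $X$ is a mapping $d\colon X\times X\to\mathbb{R}^n_+$ ($\mathbb{R}_+=[0,\infty)$) such that for all $u,v,w\in X$: $d(u,v)=0$ if and only if $u=v$; $d(u,v)=d(v,u)$; and $d(u,w)\le B\,(d(u,v)+d(v,w))$. Then $(X,d)$ is called a vector $B$-metric space. A sequence $(x_k)$ converges to $x$ (written $x_k\to x$) if $d(x_k,x)\to 0$; it is Cauchy if $d(x_k,x_p)\to0$ as $k,p\to\infty$; $(X,d)$ is complete if every Cauchy sequence converges to a point of $X$. Topological notions are sequential: a subset $F$ is closed if it contains the limit of every convergent sequence of its points; $d$ is continuous if $x_k\to x$ and $y_k\to y$ imply $d(x_k,y_k)\to d(x,y)$; $f=(f_1,\ldots,f_n)$ is lower semicontinuous if for each $i$, $x_k\to x$ implies $f_i(x)\le\liminf_{k\to\infty} f_i(x_k)$; $f$ is bounded from below if each $f_i$ is bounded from below. *)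

theory Defs
  imports "HOL-Analysis.Analysis"
begin

text \<open>
  Vectors are elements of \<^typ>\<open>real ^ 'n\<close>: the order on this type is the componentwise
  order, its topology is that of componentwise convergence, and its constant \<open>1\<close> is the vector all
  of whose entries are 1. The underlying space is a carrier set \<open>X\<close>; all conditions on
  functions and sequences are relative to it. The matrix \<open>B\<close> is arbitrary, so neither
  uniqueness of limits nor continuity of the \<open>B\<close>-metric is built in.
\<close>

definition vector_B_metric ::
    "real ^ 'n ^ 'n \<Rightarrow> 'a set \<Rightarrow> ('a \<Rightarrow> 'a \<Rightarrow> real ^ 'n) \<Rightarrow> bool" where
  "vector_B_metric B X d \<longleftrightarrow>
     (\<forall>u\<in>X. \<forall>v\<in>X. 0 \<le> d u v) \<and>
     (\<forall>u\<in>X. \<forall>v\<in>X. d u v = 0 \<longleftrightarrow> u = v) \<and>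
     (\<forall>u\<in>X. \<forall>v\<in>X. d u v = d v u) \<and>
     (\<forall>u\<in>X. \<forall>v\<in>X. \<forall>w\<in>X. d u w \<le> B *v (d u v + d v w))"

definition vB_converges :: "('a \<Rightarrow> 'a \<Rightarrow> real ^ 'n) \<Rightarrow> (nat \<Rightarrow> 'a) \<Rightarrow> 'a \<Rightarrow> bool" where
  "vB_converges d s x \<longleftrightarrow> (\<lambda>k. d (s k) x) \<longlonglongrightarrow> 0"

definition vB_Cauchy :: "('a \<Rightarrow> 'a \<Rightarrow> real ^ 'n) \<Rightarrow> (nat \<Rightarrow> 'a) \<Rightarrow> bool" where
  "vB_Cauchy d s \<longleftrightarrow>
     ((\<lambda>(k, p). d (s k) (s p)) \<longlongrightarrow> 0) (sequentially \<times>\<^sub>F sequentially)"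

definition vB_complete :: "'a set \<Rightarrow> ('a \<Rightarrow> 'a \<Rightarrow> real ^ 'n) \<Rightarrow> bool" where
  "vB_complete X d \<longleftrightarrow>
     (\<forall>s. range s \<subseteq> X \<longrightarrow> vB_Cauchy d s \<longrightarrow> (\<exists>x\<in>X. vB_converges d s x))"

definition vB_closed :: "'a set \<Rightarrow> ('a \<Rightarrow> 'a \<Rightarrow> real ^ 'n) \<Rightarrow> 'a set \<Rightarrow> bool" where
  "vB_closed X d F \<longleftrightarrow>
     F \<subseteq> X \<and> (\<forall>s. \<forall>x\<in>X. range s \<subseteq> F \<longrightarrow> vB_converges d s x \<longrightarrow> x \<in> F)"

definition vB_continuous_metric :: "'a set \<Rightarrow> ('a \<Rightarrow> 'a \<Rightarrow> real ^ 'n) \<Rightarrow> bool" where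
  "vB_continuous_metric X d \<longleftrightarrow>
     (\<forall>s t. \<forall>x\<in>X. \<forall>y\<in>X. range s \<subseteq> X \<longrightarrow> range t \<subseteq> X \<longrightarrow>
        vB_converges d s x \<longrightarrow> vB_converges d t y \<longrightarrow>
        (\<lambda>k. d (s k) (t k)) \<longlonglongrightarrow> d x y)"

text \<open>
  The lower limit of a real sequence may be infinite, so it is taken in \<^typ>\<open>ereal\<close>.
\<close>

definition vB_lsc ::
    "'a set \<Rightarrow> ('a \<Rightarrow> 'a \<Rightarrow> real ^ 'n) \<Rightarrow> ('a \<Rightarrow> real ^ 'm) \<Rightarrow> bool" where
  "vB_lsc X d f \<longleftrightarrow>
     (\<forall>i s. \<forall>x\<in>X. range s \<subseteq> X \<longrightarrow> vB_converges d s x \<longrightarrow>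
        ereal (f x $ i) \<le> liminf (\<lambda>k. ereal (f (s k) $ i)))"

definition vec_bounded_below :: "'a set \<Rightarrow> ('a \<Rightarrow> real ^ 'm) \<Rightarrow> bool" where
  "vec_bounded_below X f \<longleftrightarrow> (\<forall>i. bdd_below ((\<lambda>x. f x $ i) ` X))"

end

theory Submission
  imports Defs
begin

text \<open>
  Write \<open>c = \<epsilon> / \<delta>\<close> and attach to each point \<open>y\<close> the section
  \<open>S y = {x. f x + c d(x, y) \<le> f y}\<close>, which contains \<open>y\<close>. Lower semicontinuity of
  \<open>f\<close> and continuity of \<open>d\<close> make it closed (\<open>vB_closed_ekeland_section\<close>). Starting from
  \<open>x0\<close>, choose each new point \<open>s (n + 1)\<close> as a near-minimizer of \<open>f\<close>, with error
  \<open>\<epsilon> / (n + 2)\<close>, on the intersection of the sections of all earlier points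
  (\<open>ekeland_sequence_exists\<close>). A point \<open>x\<close> lying in the sections of \<open>s 0, \<dots>, s n\<close>
  then satisfies \<open>c d(x, s n) \<le> f (s n) - f x \<le> (\<epsilon> / (n + 1)) e\<close>: the first inequality is
  membership in \<open>S (s n)\<close>, the second is near-minimality of \<open>s n\<close>. So
  \<open>d(x, s n) \<le> (\<delta> / (n + 1)) e\<close>.

  This one estimate gives everything. Applied to later points of the sequence it gives the Cauchy
  property; the limit \<open>xs\<close> lies in every section because sections are closed. Applied to
  \<open>xs\<close> with \<open>n = 0\<close> it gives the distance bound. Finally, any point in all the sections is
  a limit of \<open>s\<close> as well, and limits are unique by the \<open>B\<close>-triangle inequality, so
  \<open>xs\<close> is the only common point of all the sections. A point \<open>x\<close> as in the first
  implication is a common point, because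
  \<open>f x + c d(x, s k) \<le> f xs + c d(xs, s k) \<le> f (s k)\<close>; and the hypothesis of the second
  implication entails that of the first by the triangle inequality through \<open>xs\<close>.

  For a metric, \<open>y' \<in> S y\<close> implies \<open>S y' \<subseteq> S y\<close> by the triangle inequality. This fails
  for general \<open>B\<close>, which is why the construction intersects all previous sections.
\<close>

definition ekeland_section ::
    "'a set \<Rightarrow> ('a \<Rightarrow> 'a \<Rightarrow> real ^ 'n) \<Rightarrow> ('a \<Rightarrow> real ^ 'n) \<Rightarrow> real \<Rightarrow> 'a \<Rightarrow> 'a set" where
  "ekeland_section X d f c y = {x\<in>X. f x + c *\<^sub>R d x y \<le> f y}"

lemma vB_closed_Int:
  assumes "vB_closed X d F" "vB_closed X d G"
  shows "vB_closed X d (F \<inter> G)"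
  using assms unfolding vB_closed_def by blast

text \<open>
  Against the constant sequence, continuity of \<open>d\<close> turns \<open>d(t k, y)\<close> into \<open>d(x, y)\<close>;
  the lower limit then passes through \<open>f (t k) \<le> f y - c d(t k, y)\<close>.
\<close>

lemma vB_closed_ekeland_section:
  fixes f :: "'a \<Rightarrow> real ^ 'n"
  assumes metric: "vector_B_metric B X d"
    and cont: "vB_continuous_metric X d"
    and lsc: "vB_lsc X d f"
    and y: "y \<in> X"
  shows "vB_closed X d (ekeland_section X d f c y)"
  unfolding vB_closed_def
proof (intro conjI allI ballI impI)
  show "ekeland_section X d f c y \<subseteq> X"
    by (auto simp: ekeland_section_def)
next
  fix t x
  assume x: "x \<in> X" and t: "range t \<subseteq> ekeland_section X d f c y"
    and lim: "vB_converges d t x"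
  have tX: "range t \<subseteq> X"
    using t by (auto simp: ekeland_section_def)
  have "d y y = 0"
    using metric y by (simp add: vector_B_metric_def)
  then have "vB_converges d (\<lambda>k. y) y"
    by (simp add: vB_converges_def)
  then have d_lim: "(\<lambda>k. d (t k) y) \<longlonglongrightarrow> d x y"
    using cont[unfolded vB_continuous_metric_def, rule_format, of x y t "\<lambda>k. y"] x y tX lim
    by (simp add: image_subset_iff)
  have "f x $ i + c * d x y $ i \<le> f y $ i" for i
  proof -
    have "ereal (f x $ i) \<le> liminf (\<lambda>k. ereal (f (t k) $ i))"
      using lsc x tX lim unfolding vB_lsc_def by blast
    also have "\<dots> \<le> liminf (\<lambda>k. ereal (f y $ i - c * d (t k) y $ i))"
    proof (intro Liminf_mono always_eventually allI)
      fix k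
      have "f (t k) + c *\<^sub>R d (t k) y \<le> f y"
        using t by (auto simp: ekeland_section_def)
      then have "f (t k) $ i + c * d (t k) y $ i \<le> f y $ i"
        by (simp add: less_eq_vec_def)
      then show "ereal (f (t k) $ i) \<le> ereal (f y $ i - c * d (t k) y $ i)"
        by simp
    qed
    also have "\<dots> = ereal (f y $ i - c * d x y $ i)"
    proof (rule lim_imp_Liminf)
      show "(\<lambda>k. ereal (f y $ i - c * d (t k) y $ i)) \<longlonglongrightarrow> ereal (f y $ i - c * d x y $ i)"
        by (intro tendsto_ereal tendsto_intros d_lim)
    qed simp
    finally show ?thesis
      by simp
  qed
  then show "x \<in> ekeland_section X d f c y"
    using x by (simp add: ekeland_section_def less_eq_vec_def)
qed

lemma ekeland_section_self:
  assumes "vector_B_metric B X d" and "y \<in> X"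
  shows "y \<in> ekeland_section X d f c y"
proof -
  have "d y y = 0"
    using assms by (simp add: vector_B_metric_def)
  then show ?thesis
    using assms(2) by (simp add: ekeland_section_def)
qed

text \<open>
  The choice depends on all earlier points, so the recursion carries the pair of the current point
  and the closed set \<open>F\<close> of points still admissible, the intersection of the sections so far.
  For \<open>n > 0\<close> near-minimality of \<open>s n\<close> holds even on \<open>\<Inter>j<n. S (s j)\<close>; stating it on the
  smaller \<open>\<Inter>j\<le>n. S (s j)\<close> includes \<open>n = 0\<close>, where the former intersection is the whole
  type and not \<open>X\<close>.
\<close>

lemma ekeland_sequence_exists:
  fixes f :: "'a \<Rightarrow> real ^ 'n" and \<eta> :: "nat \<Rightarrow> real"
  assumes metric: "vector_B_metric B X d"
    and cont: "vB_continuous_metric X d"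
    and lsc: "vB_lsc X d f"
    and near_min: "\<And>F (\<eta>::real). vB_closed X d F \<Longrightarrow> F \<noteq> {} \<Longrightarrow> \<eta> > 0 \<Longrightarrow>
           \<exists>y\<in>F. \<forall>x\<in>F. f y \<le> f x + \<eta> *\<^sub>R 1"
    and \<eta>: "\<And>n. \<eta> n > 0"
    and x0: "x0 \<in> X" and x0_min: "\<forall>x\<in>X. f x0 \<le> f x + \<eta> 0 *\<^sub>R 1"
  obtains s where "s 0 = x0" "range s \<subseteq> X"
    "\<And>j n. j < n \<Longrightarrow> s n \<in> ekeland_section X d f c (s j)"
    "\<And>n x. x \<in> (\<Inter>j\<le>n. ekeland_section X d f c (s j)) \<Longrightarrow> f (s n) \<le> f x + \<eta> n *\<^sub>R 1"
proof -
  let ?S = "ekeland_section X d f c"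
  define P where "P n = (\<lambda>(y, F). vB_closed X d F \<and> y \<in> F \<and>
      (\<forall>x\<in>F. f y \<le> f x + \<eta> n *\<^sub>R 1) \<and> (n = 0 \<longrightarrow> y = x0 \<and> F = ?S x0))" for n :: nat
  define Q where "Q = (\<lambda>(y :: 'a, F) (y', F'). y' \<in> F \<and> F' = F \<inter> ?S y')"
  have "\<exists>g. \<forall>n. P n (g n) \<and> Q (g n) (g (Suc n))"
  proof (rule dependent_nat_choice)
    have "P 0 (x0, ?S x0)"
      using vB_closed_ekeland_section[OF metric cont lsc x0] x0_min
        ekeland_section_self[OF metric x0]
      by (auto simp: P_def ekeland_section_def)
    then show "\<exists>p. P 0 p" ..
  next
    fix p n
    assume "P n p"
    then obtain y F where p: "p = (y, F)" and F: "vB_closed X d F" and y: "y \<in> F"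
      by (cases p) (auto simp: P_def)
    obtain y' where y': "y' \<in> F" and min: "\<forall>x\<in>F. f y' \<le> f x + \<eta> (Suc n) *\<^sub>R 1"
      using near_min[OF F _ \<eta>[of "Suc n"]] y by blast
    have y'X: "y' \<in> X"
      using F y' by (auto simp: vB_closed_def)
    have "P (Suc n) (y', F \<inter> ?S y')"
      using vB_closed_Int[OF F vB_closed_ekeland_section[OF metric cont lsc y'X]]
        ekeland_section_self[OF metric y'X] y' min
      by (auto simp: P_def)
    moreover have "Q p (y', F \<inter> ?S y')"
      using y' by (simp add: Q_def p)
    ultimately show "\<exists>q. P (Suc n) q \<and> Q p q"
      by blast
  qed
  then obtain g where g: "\<And>n. P n (g n)" "\<And>n. Q (g n) (g (Suc n))"
    by blast
  define s where "s n = fst (g n)" for n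
  define F where "F n = snd (g n)" for n
  have F_closed: "vB_closed X d (F n)" and s_in_F: "s n \<in> F n"
    and s_min: "\<And>x. x \<in> F n \<Longrightarrow> f (s n) \<le> f x + \<eta> n *\<^sub>R 1" for n
    using g(1)[of n] by (auto simp: P_def s_def F_def split: prod.splits)
  have s0: "s 0 = x0" and F0: "F 0 = ?S x0"
    using g(1)[of 0] by (auto simp: P_def s_def F_def split: prod.splits)
  have s_step: "s (Suc n) \<in> F n" and F_step: "F (Suc n) = F n \<inter> ?S (s (Suc n))" for n
    using g(2)[of n] by (auto simp: Q_def s_def F_def split: prod.splits)
  have F_eq: "F n = (\<Inter>j\<le>n. ?S (s j))" for n
    by (induction n) (auto simp: F0 s0 F_step atMost_Suc)
  show thesis
  proof (rule that)
    show "s 0 = x0"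
      by (rule s0)
    show "range s \<subseteq> X"
      using F_closed s_in_F unfolding vB_closed_def by blast
    show "s n \<in> ?S (s j)" if "j < n" for j n
      using s_in_F[of n] that by (auto simp: F_eq)
    show "f (s n) \<le> f x + \<eta> n *\<^sub>R 1" if "x \<in> (\<Inter>j\<le>n. ?S (s j))" for n x
      using s_min[of x n] that by (simp add: F_eq)
  qed
qed

lemma vector_B_metric_limit_unique:
  fixes d :: "'a \<Rightarrow> 'a \<Rightarrow> real ^ 'n"
  assumes metric: "vector_B_metric B X d"
    and s: "range s \<subseteq> X" and x: "x \<in> X" and y: "y \<in> X"
    and lim_x: "vB_converges d s x" and lim_y: "vB_converges d s y"
  shows "x = y"
proof -
  have "(\<lambda>k. B *v (d (s k) x + d (s k) y)) \<longlonglongrightarrow> B *v (0 + 0)"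
    using lim_x lim_y unfolding vB_converges_def
    by (intro bounded_linear.tendsto[OF matrix_vector_mul_bounded_linear] tendsto_add)
  then have lim: "(\<lambda>k. B *v (d (s k) x + d (s k) y)) \<longlonglongrightarrow> 0"
    by simp
  have bound: "d x y \<le> B *v (d (s k) x + d (s k) y)" for k
  proof -
    have "s k \<in> X"
      using s by blast
    then have "d x y \<le> B *v (d x (s k) + d (s k) y)" "d x (s k) = d (s k) x"
      using metric x y by (auto simp: vector_B_metric_def)
    then show ?thesis
      by simp
  qed
  have "d x y $ i \<le> 0" for i
  proof (rule LIMSEQ_le_const)
    show "(\<lambda>k. (B *v (d (s k) x + d (s k) y)) $ i) \<longlonglongrightarrow> 0"
      using tendsto_vec_nth[OF lim, of i] by simp
    show "\<exists>N. \<forall>k\<ge>N. d x y $ i \<le> (B *v (d (s k) x + d (s k) y)) $ i"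
      using bound by (auto simp: less_eq_vec_def)
  qed
  moreover have "0 \<le> d x y"
    using metric x y by (simp add: vector_B_metric_def)
  ultimately have "d x y = 0"
    by (simp add: vec_eq_iff less_eq_vec_def order.antisym)
  then show ?thesis
    using metric x y by (simp add: vector_B_metric_def)
qed

lemma tendsto_zero_vec_squeeze:
  fixes g :: "'b \<Rightarrow> real ^ 'n"
  assumes "eventually (\<lambda>x. 0 \<le> g x \<and> g x \<le> r x *\<^sub>R 1) A" and "(r \<longlongrightarrow> 0) A"
  shows "(g \<longlongrightarrow> 0) A"
proof (rule vec_tendstoI)
  fix i
  show "((\<lambda>x. g x $ i) \<longlongrightarrow> 0 $ i) A"
    unfolding zero_index
  proof (rule tendsto_sandwich[OF _ _ tendsto_const assms(2)])
    show "\<forall>\<^sub>F x in A. 0 \<le> g x $ i" "\<forall>\<^sub>F x in A. g x $ i \<le> r x"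
      using assms(1) by (auto simp: less_eq_vec_def elim!: eventually_mono)
  qed
qed

theorem theorem4p7:
  fixes B :: "real ^ 'n ^ 'n"
    and X :: "'a set"
    and d :: "'a \<Rightarrow> 'a \<Rightarrow> real ^ 'n"
    and f :: "'a \<Rightarrow> real ^ 'n"
    and \<epsilon> \<delta> :: real
    and x0 :: 'a
  assumes "vector_B_metric B X d"
    and "vB_complete X d"
    and "vB_continuous_metric X d"
    and "vB_lsc X d f"
    and "vec_bounded_below X f"
    and "\<And>F (\<eta>::real). vB_closed X d F \<Longrightarrow> F \<noteq> {} \<Longrightarrow> \<eta> > 0 \<Longrightarrow>
           \<exists>y\<in>F. \<forall>x\<in>F. f y \<le> f x + \<eta> *\<^sub>R 1"
    and "\<epsilon> > 0" and "\<delta> > 0" and "x0 \<in> X"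
    and "\<forall>x\<in>X. f x0 \<le> f x + \<epsilon> *\<^sub>R 1"
  shows "\<exists>s xs. s 0 = x0 \<and> range s \<subseteq> X \<and> xs \<in> X \<and> vB_converges d s xs \<and>
           f xs \<le> f x0 \<and> d xs x0 \<le> \<delta> *\<^sub>R 1 \<and>
           (\<forall>x\<in>X. (\<forall>k. f xs + (\<epsilon> / \<delta>) *\<^sub>R d xs (s k) \<ge> f x + (\<epsilon> / \<delta>) *\<^sub>R d x (s k))
              \<longrightarrow> x = xs) \<and>
           (\<forall>x\<in>X. (\<forall>k. f xs \<ge> f x + (\<epsilon> / \<delta>) *\<^sub>R (B *v d xs x)
                                  + (\<epsilon> / \<delta>) *\<^sub>R ((B - mat 1) *v d xs (s k)))
              \<longrightarrow> x = xs)"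
proof -
  define c where "c = \<epsilon> / \<delta>"
  define \<eta> where "\<eta> n = \<epsilon> / real (Suc n)" for n
  define r where "r n = \<delta> / real (Suc n)" for n
  note metric = assms(1)
  let ?S = "ekeland_section X d f c"
  have c: "c > 0"
    using assms(7,8) by (simp add: c_def)
  have \<eta>_pos: "\<eta> n > 0" for n
    using assms(7) by (simp add: \<eta>_def)
  have \<eta>_eq: "\<eta> n = c * r n" for n
    using assms(8) by (simp add: \<eta>_def c_def r_def)
  have r_lim: "r \<longlonglongrightarrow> 0"
    unfolding r_def
    using LIMSEQ_Suc[OF lim_const_over_n[of \<delta>]] by simp
  have r_nonneg: "r n \<ge> 0" for n
    using assms(8) by (simp add: r_def)
  have d_nonneg: "0 \<le> d u v" and d_sym: "d u v = d v u" if "u \<in> X" "v \<in> X" for u v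
    using metric that by (auto simp: vector_B_metric_def)
  have x0_min: "\<forall>x\<in>X. f x0 \<le> f x + \<eta> 0 *\<^sub>R 1"
    using assms(10) by (simp add: \<eta>_def)
  obtain s where s0: "s 0 = x0" and sX: "range s \<subseteq> X"
    and s_in: "\<And>j n. j < n \<Longrightarrow> s n \<in> ?S (s j)"
    and s_min: "\<And>n x. x \<in> (\<Inter>j\<le>n. ?S (s j)) \<Longrightarrow> f (s n) \<le> f x + \<eta> n *\<^sub>R 1"
    by (rule ekeland_sequence_exists[OF metric assms(3,4) _ _ assms(9), of \<eta> c])
      (use assms(6) \<eta>_pos x0_min in auto)
  have sX': "s k \<in> X" for k
    using sX by blast

  \<comment> \<open>Membership in \<open>S (s n)\<close> bounds \<open>c d(x, s n)\<close> by the decrease of \<open>f\<close>, which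
      near-minimality bounds by \<open>\<eta> n\<close>.\<close>
  have close: "d x (s n) \<le> r n *\<^sub>R 1" if x: "x \<in> (\<Inter>j\<le>n. ?S (s j))" for x n
  proof -
    have "x \<in> ?S (s n)"
      using x by blast
    then have "f x $ i + c * d x (s n) $ i \<le> f (s n) $ i" for i
      by (simp add: ekeland_section_def less_eq_vec_def)
    moreover have "f (s n) $ i \<le> f x $ i + c * r n" for i
      using s_min[OF x] by (simp add: less_eq_vec_def \<eta>_eq)
    ultimately have "f x $ i + c * d x (s n) $ i \<le> f x $ i + c * r n" for i
      by (rule order_trans)
    then show ?thesis
      using c by (simp add: less_eq_vec_def)
  qed

  have later: "d (s p) (s k) \<le> r k *\<^sub>R 1" if "k < p" for k p
    using that by (intro close) (auto intro: s_in)
  have "vB_Cauchy d s"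
    unfolding vB_Cauchy_def
  proof (rule tendsto_zero_vec_squeeze)
    \<comment> \<open>Whichever index is smaller controls the distance, so the sum of both radii bounds it.\<close>
    have "d (s k) (s p) \<le> (r k + r p) *\<^sub>R 1" for k p
    proof (cases k p rule: linorder_cases)
      case less
      then show ?thesis
        using later[of k p] d_sym[OF sX' sX', of k p] r_nonneg[of p]
        by (auto simp: less_eq_vec_def intro: add_increasing2)
    next
      case equal
      have "d (s p) (s p) = 0"
        using metric sX' by (simp add: vector_B_metric_def)
      then show ?thesis
        using equal r_nonneg[of p] by (simp add: less_eq_vec_def)
    next
      case greater
      then show ?thesis
        using later[of p k] r_nonneg[of k]
        by (auto simp: less_eq_vec_def intro: add_increasing)
    qed
    then show "\<forall>\<^sub>F q in sequentially \<times>\<^sub>F sequentially.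
        0 \<le> (case q of (k, p) \<Rightarrow> d (s k) (s p)) \<and>
        (case q of (k, p) \<Rightarrow> d (s k) (s p)) \<le> (r (fst q) + r (snd q)) *\<^sub>R 1"
      using d_nonneg[OF sX' sX'] by (intro always_eventually) auto
    show "((\<lambda>q. r (fst q) + r (snd q)) \<longlongrightarrow> 0) (sequentially \<times>\<^sub>F sequentially)"
      using tendsto_add[OF filterlim_compose[OF r_lim filterlim_fst]
          filterlim_compose[OF r_lim filterlim_snd]] by simp
  qed
  then obtain xs where xs: "xs \<in> X" and lim: "vB_converges d s xs"
    using assms(2) sX unfolding vB_complete_def by blast

  have xs_in: "xs \<in> ?S (s j)" for j
  proof -
    have "vB_converges d (\<lambda>k. s (k + Suc j)) xs"
      using lim unfolding vB_converges_def by (rule LIMSEQ_ignore_initial_segment)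
    moreover have "range (\<lambda>k. s (k + Suc j)) \<subseteq> ?S (s j)"
      using s_in by auto
    ultimately show ?thesis
      using vB_closed_ekeland_section[OF metric assms(3,4) sX', where c = c] xs
      unfolding vB_closed_def by blast
  qed

  have common: "x = xs" if x: "x \<in> X" and x_in: "\<And>k. x \<in> ?S (s k)" for x
  proof (rule vector_B_metric_limit_unique[OF metric sX x xs _ lim])
    have "d (s k) x \<le> r k *\<^sub>R 1" for k
      using close[of x k] x_in d_sym[OF x sX'] by simp
    then show "vB_converges d s x"
      unfolding vB_converges_def
      using d_nonneg[OF sX' x] by (intro tendsto_zero_vec_squeeze[OF _ r_lim]) simp
  qed

  have first: "x = xs"
    if x: "x \<in> X" and le: "\<And>k. f x + c *\<^sub>R d x (s k) \<le> f xs + c *\<^sub>R d xs (s k)" for x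
  proof (rule common[OF x])
    fix k
    have "f xs + c *\<^sub>R d xs (s k) \<le> f (s k)"
      using xs_in[of k] by (simp add: ekeland_section_def)
    then show "x \<in> ?S (s k)"
      using x le[of k] by (simp add: ekeland_section_def)
  qed

  have second: "x = xs"
    if x: "x \<in> X" and le: "\<And>k. f x + c *\<^sub>R (B *v d xs x) + c *\<^sub>R ((B - mat 1) *v d xs (s k)) \<le> f xs"
    for x
  proof (rule first[OF x])
    fix k
    have "d x (s k) \<le> B *v (d x xs + d xs (s k))"
      using metric x xs sX' by (simp add: vector_B_metric_def)
    then have "c *\<^sub>R d x (s k) \<le> c *\<^sub>R (B *v d xs x + B *v d xs (s k))"
      using c d_sym[OF x xs] by (simp add: less_eq_vec_def matrix_vector_right_distrib)
    moreover have "f x + c *\<^sub>R (B *v d xs x + B *v d xs (s k)) \<le> f xs + c *\<^sub>R d xs (s k)"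
      using le[of k] by (simp add: matrix_vector_mult_diff_rdistrib algebra_simps)
    ultimately show "f x + c *\<^sub>R d x (s k) \<le> f xs + c *\<^sub>R d xs (s k)"
      by (meson add_left_mono order_trans)
  qed

  have "f xs + c *\<^sub>R d xs x0 \<le> f x0"
    using xs_in[of 0] by (simp add: ekeland_section_def s0)
  moreover have "0 \<le> c *\<^sub>R d xs x0"
    using c d_nonneg[OF xs assms(9)] by (simp add: less_eq_vec_def)
  ultimately have "f xs \<le> f x0"
    by (meson le_add_same_cancel1 order_trans)
  moreover have "d xs x0 \<le> \<delta> *\<^sub>R 1"
    using close[of xs 0] xs_in[of 0] by (simp add: s0 r_def)
  ultimately show ?thesis
    using s0 sX xs lim first second unfolding c_def by blast
qed

end
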